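(* Let $L$ be a set given with a partial order and a metric $d$, such that at least one of the following holds: (i) $L$ is an upper semilattice (in particular, this includes the case where $L$ is a lattice) and $d(x\vee y,\,x\vee z)\le d(y,z)$ for all $x,y,z\in L$; or (ii) $L$ is a lower semilattice (in particular, this includes the case where $L$ is a lattice) and $d(x\wedge y,\,x\wedge z)\le d(y,z)$ for all $x,y,z\in L$. Suppose moreover that in $L$ every increasing Cauchy sequence $x_0\le x_1\le\dots\le x_n\le\dots$ converges, and every decreasing Cauchy sequence $x_0\ge x_1\ge\dots\ge x_n\ge\dots$ converges (Cauchyness and convergence being with respect to $d$). Then every Cauchy sequence in $L$ converges; i.e., $L$ is complete as a metric space.
   Context: An upper (respectively lower) semilattice is a partially ordered set in which every two elements $x,y$ have a least upper bound $x\vee y$ (respectively a greatest lower bound $x\wedge y$); a lattice is a partially ordered set that is both. No relation between the metric and the order is assumed other than those stated. *)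

theory Defs
  imports "HOL-Analysis.Abstract_Metric_Spaces" "HOL-Algebra.Lattice"
begin

end

theory Submission
  imports Defs "HOL-Algebra.Complete_Lattice"
begin

text \<open>
  Pass to a subsequence \<open>w\<close> with \<open>d (w n) (w (n + 1)) \<le> 2\<^sup>-\<^sup>n\<close>. In case (i) the map
  \<open>y \<mapsto> x \<squnion> y\<close> is nonexpansive, so the partial joins \<open>w n \<squnion> \<dots> \<squnion> w (n + k)\<close> move by at most
  \<open>2\<^sup>-\<^sup>n\<^sup>-\<^sup>k\<close> when \<open>k\<close> grows by one; they form an increasing Cauchy sequence whose limit \<open>z n\<close>
  is within \<open>2 / 2\<^sup>n\<close> of \<open>w n\<close>. Continuity gives \<open>z n = w n \<squnion> z (n + 1)\<close>, so \<open>z\<close> is a decreasing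
  Cauchy sequence, and its limit is also that of \<open>w\<close>. Only associativity, idempotence and
  the upper bound property of \<open>\<squnion>\<close> enter, so the same argument covers \<open>\<sqinter>\<close> with the order reversed.
\<close>

primrec partial_fold :: "('a \<Rightarrow> 'a \<Rightarrow> 'a) \<Rightarrow> (nat \<Rightarrow> 'a) \<Rightarrow> nat \<Rightarrow> 'a" where
  "partial_fold f x 0 = x 0"
| "partial_fold f x (Suc k) = f (partial_fold f x k) (x (Suc k))"

lemma partial_fold_closed:
  assumes "\<And>a b. a \<in> M \<Longrightarrow> b \<in> M \<Longrightarrow> f a b \<in> M" and "\<And>n. x n \<in> M"
  shows "partial_fold f x k \<in> M"
  using assms by (induction k) auto

text \<open>The recursion appends terms at the right end; associativity lets the first term be split
  off instead. In the limit this yields the recursion for \<open>z\<close>.\<close>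

lemma partial_fold_Suc_shift:
  assumes closed: "\<And>a b. a \<in> M \<Longrightarrow> b \<in> M \<Longrightarrow> f a b \<in> M" and x: "\<And>n. x n \<in> M"
    and assoc: "\<And>a b c. a \<in> M \<Longrightarrow> b \<in> M \<Longrightarrow> c \<in> M \<Longrightarrow> f (f a b) c = f a (f b c)"
  shows "partial_fold f x (Suc k) = f (x 0) (partial_fold f (\<lambda>n. x (Suc n)) k)"
proof (induction k)
  case (Suc k)
  have "partial_fold f (\<lambda>n. x (Suc n)) k \<in> M"
    by (intro partial_fold_closed closed x)
  then show ?case
    using Suc assoc x by simp
qed simp

text \<open>The last term is already the final factor of the fold, so associativity and idempotence
  absorb a second copy.\<close>

lemma partial_fold_absorb:
  assumes closed: "\<And>a b. a \<in> M \<Longrightarrow> b \<in> M \<Longrightarrow> f a b \<in> M" and x: "\<And>n. x n \<in> M"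
    and assoc: "\<And>a b c. a \<in> M \<Longrightarrow> b \<in> M \<Longrightarrow> c \<in> M \<Longrightarrow> f (f a b) c = f a (f b c)"
    and idem: "\<And>a. a \<in> M \<Longrightarrow> f a a = a"
  shows "f (partial_fold f x k) (x k) = partial_fold f x k"
  using assms partial_fold_closed[of M f x] by (cases k) auto

context Metric_space
begin

lemma geometric_dist_le:
  assumes y: "\<And>n. y n \<in> M" and step: "\<And>n. d (y n) (y (Suc n)) \<le> c / 2 ^ n"
  shows "d (y m) (y (m + p)) \<le> 2 * c / 2 ^ m"
proof -
  have "0 \<le> c"
    using order_trans[OF nonneg step[of 0]] by simp
  \<comment> \<open>The subtracted remainder of the geometric series is what makes the induction
    close: each step uses up exactly half of it.\<close>
  have "d (y m) (y (m + p)) \<le> 2 * c / 2 ^ m - 2 * c / 2 ^ (m + p)"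
  proof (induction p)
    case (Suc p)
    have "d (y m) (y (m + Suc p)) \<le> d (y m) (y (m + p)) + d (y (m + p)) (y (Suc (m + p)))"
      using triangle y by simp
    also have "\<dots> \<le> (2 * c / 2 ^ m - 2 * c / 2 ^ (m + p)) + c / 2 ^ (m + p)"
      using Suc step by (intro add_mono)
    also have "\<dots> = 2 * c / 2 ^ m - 2 * c / 2 ^ (m + Suc p)"
      by simp
    finally show ?case .
  qed (use y in simp)
  moreover have "0 \<le> 2 * c / 2 ^ (m + p)"
    using \<open>0 \<le> c\<close> by simp
  ultimately show ?thesis
    by linarith
qed

lemma MCauchy_geometric:
  assumes y: "\<And>n. y n \<in> M" and step: "\<And>n. d (y n) (y (Suc n)) \<le> c / 2 ^ n"
  shows "MCauchy y"
  unfolding MCauchy_def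
proof (intro conjI strip)
  show "range y \<subseteq> M"
    using y by auto
  fix e :: real assume "0 < e"
  \<comment> \<open>The factor 4 arises because two points beyond \<open>N\<close> are each within
    \<open>2 * c / 2 ^ N\<close> of \<open>y N\<close>.\<close>
  have "(\<lambda>n. (4 * c) * (1 / 2) ^ n) \<longlonglongrightarrow> (4 * c) * 0"
    by (intro tendsto_mult_left LIMSEQ_realpow_zero) auto
  then have "\<forall>\<^sub>F n in sequentially. (4 * c) * (1 / 2) ^ n < e"
    using \<open>0 < e\<close> by (intro order_tendstoD(2)) auto
  then obtain N where N: "4 * c / 2 ^ N < e"
    by (auto simp: eventually_sequentially power_divide)
  have "d (y n) (y n') < e" if "N \<le> n" "N \<le> n'" for n n'
  proof -
    have "d (y N) (y n) \<le> 2 * c / 2 ^ N" "d (y N) (y n') \<le> 2 * c / 2 ^ N"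
      using geometric_dist_le[OF y step, of N "n - N"] geometric_dist_le[OF y step, of N "n' - N"] that
      by auto
    moreover have "d (y n) (y n') \<le> d (y N) (y n) + d (y N) (y n')"
      using triangle'' y by simp
    ultimately show ?thesis
      using N by simp
  qed
  then show "\<exists>N. \<forall>n n'. N \<le> n \<longrightarrow> N \<le> n' \<longrightarrow> d (y n) (y n') < e"
    by blast
qed

lemma MCauchy_geometric_subsequence:
  assumes "MCauchy x"
  obtains r where "strict_mono r" "\<And>n. d (x (r n)) (x (r (Suc n))) \<le> 1 / 2 ^ n"
proof -
  define tail where "tail n N \<longleftrightarrow> (\<forall>i\<ge>N. \<forall>j\<ge>N. d (x i) (x j) < 1 / 2 ^ n)" for n N
  have ex: "\<exists>N. tail n N" for n
    using assms unfolding MCauchy_def tail_def by (metis half_gt_zero_iff zero_less_divide_1_iff zero_less_numeral zero_less_power)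
  have "\<exists>r. \<forall>n. tail n (r n) \<and> r n < r (Suc n)"
  proof (rule dependent_nat_choice)
    show "\<exists>N. tail 0 N"
      by (rule ex)
    fix m n
    obtain N where "tail (Suc n) N"
      using ex by blast
    \<comment> \<open>\<open>tail\<close> persists when the starting index grows, so the index may
      be pushed past \<open>m\<close>.\<close>
    then show "\<exists>N. tail (Suc n) N \<and> m < N"
      by (intro exI[of _ "max N (Suc m)"]) (auto simp: tail_def)
  qed
  then obtain r where r: "\<And>n. tail n (r n)" "\<And>n. r n < r (Suc n)"
    by blast
  show thesis
  proof (rule that)
    show "strict_mono r"
      using r(2) by (simp add: strict_mono_Suc_iff)
    show "d (x (r n)) (x (r (Suc n))) \<le> 1 / 2 ^ n" for n
      using r unfolding tail_def by (meson less_imp_le order_refl)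
  qed
qed

text \<open>Closed balls are closed under limits; this carries bounds on partial folds over to
  \<open>z n\<close>.\<close>

lemma limitin_dist_le:
  assumes lim: "limitin mtopology y l sequentially" and "a \<in> M" and y: "\<And>n. y n \<in> M"
    and le: "\<And>n. d a (y n) \<le> c"
  shows "d a l \<le> c"
proof (rule field_le_epsilon)
  fix e :: real assume "0 < e"
  then obtain n where "d (y n) l < e"
    using lim unfolding limit_metric_sequentially by blast
  moreover have "d a l \<le> d a (y n) + d (y n) l"
    using triangle \<open>a \<in> M\<close> y lim limitin_metric by blast
  ultimately show "d a l \<le> c + e"
    using le[of n] by linarith
qed

lemma limitin_nonexpansive:
  assumes lim: "limitin mtopology y l sequentially"
    and closed: "\<And>a. a \<in> M \<Longrightarrow> g a \<in> M"
    and nonexp: "\<And>a b. a \<in> M \<Longrightarrow> b \<in> M \<Longrightarrow> d (g a) (g b) \<le> d a b"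
  shows "limitin mtopology (\<lambda>n. g (y n)) (g l) sequentially"
  using assms unfolding limit_metric_sequentially by (meson le_less_trans)

text \<open>The relation \<open>R\<close> is left abstract so that reversing the order merely
  exchanges the roles of \<open>incr\<close> and \<open>decr\<close>.\<close>

lemma mcomplete_semilattice:
  assumes closed: "\<And>a b. a \<in> M \<Longrightarrow> b \<in> M \<Longrightarrow> f a b \<in> M"
    and assoc: "\<And>a b c. a \<in> M \<Longrightarrow> b \<in> M \<Longrightarrow> c \<in> M \<Longrightarrow> f (f a b) c = f a (f b c)"
    and idem: "\<And>a. a \<in> M \<Longrightarrow> f a a = a"
    and left: "\<And>a b. a \<in> M \<Longrightarrow> b \<in> M \<Longrightarrow> R a (f a b)"
    and right: "\<And>a b. a \<in> M \<Longrightarrow> b \<in> M \<Longrightarrow> R b (f a b)"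
    and nonexp: "\<And>a b c. a \<in> M \<Longrightarrow> b \<in> M \<Longrightarrow> c \<in> M \<Longrightarrow> d (f a b) (f a c) \<le> d b c"
    and incr: "\<And>x. MCauchy x \<Longrightarrow> (\<forall>n. R (x n) (x (Suc n))) \<Longrightarrow> \<exists>l. limitin mtopology x l sequentially"
    and decr: "\<And>x. MCauchy x \<Longrightarrow> (\<forall>n. R (x (Suc n)) (x n)) \<Longrightarrow> \<exists>l. limitin mtopology x l sequentially"
  shows "mcomplete"
  unfolding mcomplete_def
proof (intro strip)
  fix x assume cau: "MCauchy x"
  obtain r where r: "strict_mono r" "\<And>n. d (x (r n)) (x (r (Suc n))) \<le> 1 / 2 ^ n"
    using MCauchy_geometric_subsequence[OF cau] by blast
  define w where "w = x \<circ> r"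
  have w: "w n \<in> M" for n
    using cau by (auto simp: w_def MCauchy_def)
  have step: "d (w n) (w (Suc n)) \<le> 1 / 2 ^ n" for n
    using r(2) by (simp add: w_def)
  define y where "y n = partial_fold f (\<lambda>k. w (n + k))" for n
  have y: "y n k \<in> M" for n k
    unfolding y_def by (intro partial_fold_closed closed w)
  have y_step: "d (y n k) (y n (Suc k)) \<le> (1 / 2 ^ n) / 2 ^ k" for n k
  proof -
    \<comment> \<open>Repeating the last term gives consecutive folds the same left argument, as
      \<open>nonexp\<close> requires.\<close>
    have "f (y n k) (w (n + k)) = y n k"
      unfolding y_def by (rule partial_fold_absorb[where M = M]) (auto simp: closed w assoc idem)
    then have "d (y n k) (y n (Suc k)) = d (f (y n k) (w (n + k))) (f (y n k) (w (Suc (n + k))))"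
      by (simp add: y_def)
    also have "\<dots> \<le> d (w (n + k)) (w (Suc (n + k)))"
      by (intro nonexp y w)
    also have "\<dots> \<le> (1 / 2 ^ n) / 2 ^ k"
      using step[of "n + k"] by (simp add: power_add)
    finally show ?thesis .
  qed
  have "\<exists>l. limitin mtopology (y n) l sequentially" for n
  proof (rule incr)
    show "MCauchy (y n)"
      using y y_step by (rule MCauchy_geometric)
    show "\<forall>k. R (y n k) (y n (Suc k))"
      using left y w by (simp add: y_def)
  qed
  then obtain z where z_lim: "\<And>n. limitin mtopology (y n) (z n) sequentially"
    by metis
  have z: "z n \<in> M" for n
    using z_lim limitin_metric by blast
  have wz: "d (w n) (z n) \<le> 2 / 2 ^ n" for n
  proof (rule limitin_dist_le[OF z_lim w y])
    \<comment> \<open>Here \<open>w n\<close> is \<open>y n 0\<close>, so the geometric estimate is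
      taken from index 0.\<close>
    show "d (w n) (y n k) \<le> 2 / 2 ^ n" for k
      using geometric_dist_le[of "y n" "1 / 2 ^ n" 0 k] y y_step by (simp add: y_def)
  qed
  \<comment> \<open>Both sides are limits of the shifted sequence of folds
    \<open>y n (Suc k)\<close>, and limits are unique.\<close>
  have z_rec: "z n = f (w n) (z (Suc n))" for n
  proof (rule limitin_metric_unique)
    have "y n (Suc k) = f (w n) (y (Suc n) k)" for k
      using partial_fold_Suc_shift[of M f "\<lambda>k. w (n + k)" k] closed w assoc by (simp add: y_def)
    then show "limitin mtopology (\<lambda>k. y n (Suc k)) (f (w n) (z (Suc n))) sequentially"
      using limitin_nonexpansive[OF z_lim, of "f (w n)" "Suc n"] closed nonexp w by simp
    show "limitin mtopology (\<lambda>k. y n (Suc k)) (z n) sequentially"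
      using limitin_sequentially_offset[OF z_lim, of n 1] by simp
  qed simp
  have "\<exists>l. limitin mtopology z l sequentially"
  proof (rule decr)
    \<comment> \<open>The route from \<open>z n\<close> through \<open>w n\<close> and
      \<open>w (Suc n)\<close> costs 2 + 1 + 1 units of \<open>1 / 2 ^ n\<close>.\<close>
    have "d (z n) (z (Suc n)) \<le> 4 / 2 ^ n" for n
    proof -
      have "d (z n) (z (Suc n)) \<le> d (w n) (z n) + d (w n) (w (Suc n)) + d (w (Suc n)) (z (Suc n))"
        using triangle[of "w n" "w (Suc n)" "z (Suc n)"] triangle''[of "z n" "w n" "z (Suc n)"] w z
        by simp
      also have "\<dots> \<le> 2 / 2 ^ n + 1 / 2 ^ n + 2 / 2 ^ Suc n"
        by (intro add_mono wz step)
      finally show ?thesis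
        by simp
    qed
    then show "MCauchy z"
      using z MCauchy_geometric by blast
    show "\<forall>n. R (z (Suc n)) (z n)"
      using right w z z_rec by metis
  qed
  then obtain l where l: "limitin mtopology z l sequentially" ..
  have "l \<in> M"
    using l limitin_metric by blast
  \<comment> \<open>The gap between \<open>w n\<close> and \<open>z n\<close> vanishes, so
    \<open>w\<close> inherits the limit of \<open>z\<close>; a Cauchy sequence converges with its
    subsequence.\<close>
  have "(\<lambda>n. d (w n) l) \<longlonglongrightarrow> 0"
  proof (rule tendsto_sandwich[of "\<lambda>_. 0"])
    show "\<forall>\<^sub>F n in sequentially. d (w n) l \<le> 2 * (1 / 2) ^ n + d (z n) l"
    proof (intro always_eventually allI)
      fix n
      show "d (w n) l \<le> 2 * (1 / 2) ^ n + d (z n) l"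
        using triangle[of "w n" "z n" l] wz[of n] w z \<open>l \<in> M\<close> by (simp add: power_divide)
    qed
    have "(\<lambda>n. d (z n) l) \<longlonglongrightarrow> 0"
      using l by (simp add: limitin_metric_dist_null)
    then have "(\<lambda>n. 2 * (1 / 2) ^ n + d (z n) l) \<longlonglongrightarrow> 2 * 0 + 0"
      by (intro tendsto_add tendsto_mult_left LIMSEQ_realpow_zero) auto
    then show "(\<lambda>n. 2 * (1 / 2) ^ n + d (z n) l) \<longlonglongrightarrow> 0"
      by simp
  qed auto
  then have "limitin mtopology (x \<circ> r) l sequentially"
    using w \<open>l \<in> M\<close> by (simp add: limitin_metric_dist_null w_def)
  then show "\<exists>l. limitin mtopology x l sequentially"
    using MCauchy_convergent_subsequence[OF cau r(1)] by blast
qed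

end

theorem theorem9:
  fixes L :: "('a, 'b) gorder_scheme" and d :: "'a \<Rightarrow> 'a \<Rightarrow> real"
  assumes "partial_order L"
    and "Metric_space (carrier L) d"
    and "(upper_semilattice L \<and>
           (\<forall>x\<in>carrier L. \<forall>y\<in>carrier L. \<forall>z\<in>carrier L.
              d (x \<squnion>\<^bsub>L\<^esub> y) (x \<squnion>\<^bsub>L\<^esub> z) \<le> d y z)) \<or>
         (lower_semilattice L \<and>
           (\<forall>x\<in>carrier L. \<forall>y\<in>carrier L. \<forall>z\<in>carrier L.
              d (x \<sqinter>\<^bsub>L\<^esub> y) (x \<sqinter>\<^bsub>L\<^esub> z) \<le> d y z))"
    and "\<And>x :: nat \<Rightarrow> 'a. Metric_space.MCauchy (carrier L) d x \<Longrightarrow> (\<forall>n. x n \<sqsubseteq>\<^bsub>L\<^esub> x (Suc n)) \<Longrightarrow>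
           \<exists>l. limitin (Metric_space.mtopology (carrier L) d) x l sequentially"
    and "\<And>x :: nat \<Rightarrow> 'a. Metric_space.MCauchy (carrier L) d x \<Longrightarrow> (\<forall>n. x (Suc n) \<sqsubseteq>\<^bsub>L\<^esub> x n) \<Longrightarrow>
           \<exists>l. limitin (Metric_space.mtopology (carrier L) d) x l sequentially"
  shows "Metric_space.mcomplete (carrier L) d"
proof -
  interpret Metric_space "carrier L" d
    by fact
  from assms(3) show ?thesis
  proof (elim disjE conjE)
    assume "upper_semilattice L"
      and nonexp: "\<forall>x\<in>carrier L. \<forall>y\<in>carrier L. \<forall>z\<in>carrier L.
              d (x \<squnion>\<^bsub>L\<^esub> y) (x \<squnion>\<^bsub>L\<^esub> z) \<le> d y z"
    then interpret upper_semilattice L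
      by simp
    show ?thesis
    proof (rule mcomplete_semilattice[where f = "join L" and R = "le L"])
      \<comment> \<open>By antisymmetry: \<open>a\<close> is itself an upper bound of the pair
        \<open>a\<close>, \<open>a\<close>.\<close>
      show "a \<squnion>\<^bsub>L\<^esub> a = a" if "a \<in> carrier L" for a
        using that by (intro le_antisym join_le join_left) auto
    qed (use nonexp in \<open>auto simp: join_assoc join_left join_right intro: assms(4,5)\<close>)
  next
    assume "lower_semilattice L"
      and nonexp: "\<forall>x\<in>carrier L. \<forall>y\<in>carrier L. \<forall>z\<in>carrier L.
              d (x \<sqinter>\<^bsub>L\<^esub> y) (x \<sqinter>\<^bsub>L\<^esub> z) \<le> d y z"
    then interpret lower_semilattice L
      by simp
    show ?thesis
    \<comment> \<open>With the order reversed, partial meets descend and their limits ascend, so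
      \<open>assms(5)\<close> serves as \<open>incr\<close> and \<open>assms(4)\<close> as
      \<open>decr\<close>.\<close>
    proof (rule mcomplete_semilattice[where f = "meet L" and R = "\<lambda>a b. le L b a"])
      show "a \<sqinter>\<^bsub>L\<^esub> a = a" if "a \<in> carrier L" for a
        using that by (intro le_antisym meet_le meet_left) auto
    qed (use nonexp in \<open>auto simp: meet_assoc meet_left meet_right intro: assms(4,5)\<close>)
  qed
qed

end
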